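(* Let $\kappa$ be an uncountable cardinal and let $X_\kappa$ be Uspenskij's example of cardinality $\kappa$, that is, a subspace of $[0,1]^\kappa$ (with the product topology) such that: (i) $X_\kappa$ is dense in $[0,1]^\kappa$; (ii) $X_\kappa$ is the union of a countable collection of subsets each of which is closed in $X_\kappa$, discrete, and of cardinality $\kappa$; (iii) for every $f\in X_\kappa$ the set $\{\alpha\in\kappa: f(\alpha)\neq 0\}$ is finite; (iv) there is a countable set $C\subset[0,1]$ such that $f[\kappa]\subset C$ for every $f\in X_\kappa$. Then $X_\kappa$ is functionally countable, has a $G_\delta$ diagonal, has extent $\kappa$, and is not exponentially separable.
   Context: The existence of a space with properties (i)-(iv), for each $\kappa$, is a known result of Uspenskij (1984). A space $X$ has a $G_\delta$ diagonal if $\{(x,x):x\in X\}$ is a $G_\delta$ subset of $X\times X$. The extent of $X$ is the supremum of the cardinalities of its closed discrete subsets. A space $X$ is functionally countable if $f[X]$ is countable for every continuous $f\colon X\to\mathbb{R}$. Given a family $\mathcal{F}$ of subsets of $X$, a set $A\subset X$ is strongly dense in $\mathcal{F}$ if $A\cap\bigcap\mathcal{G}\neq\emptyset$ whenever $\mathcal{G}\subset\mathcal{F}$ and $\bigcap\mathcal{G}\neq\emptyset$. $X$ is exponentially separable if for every countable family $\mathcal{F}$ of closed subsets of $X$ there is a countable $A\subset X$ that is strongly dense in $\mathcal{F}$. *)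

theory Defs
  imports "HOL-Analysis.Analysis"
begin

unbundle cardinal_syntax

(* A cardinal is a cardinal-order relation kappa; the coordinates alpha \<in> kappa are the
   elements of Field kappa. *)
definition tychonoff_cube :: "'k rel \<Rightarrow> ('k \<Rightarrow> real) topology" where
  "tychonoff_cube \<kappa> = product_topology (\<lambda>_. top_of_set {0..1}) (Field \<kappa>)"

definition dense_in :: "'a topology \<Rightarrow> 'a set \<Rightarrow> bool" where
  "dense_in T S \<longleftrightarrow> S \<subseteq> topspace T \<and> T closure_of S = topspace T"

definition closed_discrete_in :: "'a topology \<Rightarrow> 'a set \<Rightarrow> bool" where
  "closed_discrete_in T D \<longleftrightarrow> closedin T D \<and> subtopology T D = discrete_topology D"

definition functionally_countable :: "'a topology \<Rightarrow> bool" where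
  "functionally_countable T \<longleftrightarrow>
     (\<forall>f. continuous_map T euclideanreal f \<longrightarrow> countable (f ` topspace T))"

definition has_gdelta_diagonal :: "'a topology \<Rightarrow> bool" where
  "has_gdelta_diagonal T \<longleftrightarrow> gdelta_in (prod_topology T T) {(x, x) | x. x \<in> topspace T}"

(* The extent is the least upper bound, among cardinals, of the cardinalities of the closed
   discrete sets. Comparing r only with cardinals s on its own carrier type loses nothing: every
   cardinal below r has a copy on a subset of Field r. *)
definition has_extent :: "'a topology \<Rightarrow> 'k rel \<Rightarrow> bool" where
  "has_extent T r \<longleftrightarrow> Card_order r \<and>
     (\<forall>D. closed_discrete_in T D \<longrightarrow> |D| \<le>o r) \<and>
     (\<forall>s :: 'k rel. Card_order s \<and> (\<forall>D. closed_discrete_in T D \<longrightarrow> |D| \<le>o s) \<longrightarrow> r \<le>o s)"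

(* Intersecting with topspace T matters for the empty subfamily only, whose intersection is read
   as the whole space. *)
definition strongly_dense_in :: "'a topology \<Rightarrow> 'a set \<Rightarrow> 'a set set \<Rightarrow> bool" where
  "strongly_dense_in T A \<F> \<longleftrightarrow> A \<subseteq> topspace T \<and>
     (\<forall>\<G>\<subseteq>\<F>. topspace T \<inter> \<Inter>\<G> \<noteq> {} \<longrightarrow> A \<inter> \<Inter>\<G> \<noteq> {})"

definition exponentially_separable :: "'a topology \<Rightarrow> bool" where
  "exponentially_separable T \<longleftrightarrow>
     (\<forall>\<F>. countable \<F> \<and> (\<forall>F\<in>\<F>. closedin T F) \<longrightarrow>
        (\<exists>A. countable A \<and> strongly_dense_in T A \<F>))"

end

theory Submission
  imports Defs "HOL-Probability.Probability"
begin

text \<open>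
  A product of separable spaces is ccc: each factor carries a probability measure charging every
  nonempty open set, so in the product measure nonempty basic boxes have positive measure and
  disjoint families of them are countable. Hence every open set of the product has a dense part
  that depends on countably many coordinates only, and a continuous real function on a dense
  subspace depends on countably many coordinates. Points of \<open>X\<close> have finite support and
  values in a fixed countable set, so they have only countably many restrictions to a countable
  set of coordinates.

  A finite product of closed discrete sets is closed discrete, and so are its subsets; this makes
  the complement of the diagonal an F-sigma set. An uncountable closed discrete set has an
  uncountable subset \<open>E\<close> with an injection \<open>g\<close> to the reals. The sets
  \<open>g \<le> q\<close> and \<open>g \<ge> q\<close> in \<open>E\<close>, for rational \<open>q\<close>, form a countable
  family of closed sets that cuts out every point of \<open>E\<close>, so no countable set is strongly
  dense in it.
\<close>

section \<open>Products of separable spaces\<close>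

text \<open>Finite subsums of the measures are bounded by the total mass, so the family of measures
  is summable, and a summable family has only countably many nonzero terms.\<close>

lemma (in finite_measure) countable_disjoint_family_positive:
  assumes "disjoint_family_on A I" and "\<And>i. i \<in> I \<Longrightarrow> A i \<in> sets M"
    and "\<And>i. i \<in> I \<Longrightarrow> measure M (A i) > 0"
  shows "countable I"
proof -
  have "(\<lambda>i. measure M (A i)) summable_on I"
  proof (rule nonneg_bdd_above_summable_on)
    show "bdd_above (sum (\<lambda>i. measure M (A i)) ` {F. F \<subseteq> I \<and> finite F})"
    proof (rule bdd_aboveI2)
      fix F assume F: "F \<in> {F. F \<subseteq> I \<and> finite F}"
      then have "(\<Sum>i\<in>F. measure M (A i)) = measure M (\<Union>i\<in>F. A i)"
        using assms by (intro finite_measure_finite_Union [symmetric])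
          (auto intro: disjoint_family_on_mono)
      also have "\<dots> \<le> measure M (space M)"
        by (rule bounded_measure)
      finally show "(\<Sum>i\<in>F. measure M (A i)) \<le> measure M (space M)" .
    qed
  qed auto
  then have "countable {i \<in> I. measure M (A i) \<noteq> 0}"
    by (intro abs_summable_countable) simp
  moreover have "{i \<in> I. measure M (A i) \<noteq> 0} = I"
    using assms(3) by fastforce
  ultimately show ?thesis by simp
qed

text \<open>A basic open set is represented by its tuple of sides, so that the finitely many
  coordinates it restricts can be read off.\<close>

definition open_box :: "('i \<Rightarrow> 'a topology) \<Rightarrow> 'i set \<Rightarrow> ('i \<Rightarrow> 'a set) \<Rightarrow> bool" where
  "open_box Y K U \<longleftrightarrow> finite {i \<in> K. U i \<noteq> topspace (Y i)} \<and> (\<forall>i\<in>K. openin (Y i) (U i))"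

lemma openin_product_topology_open_box:
  "openin (product_topology Y K) S \<longleftrightarrow>
    (\<forall>x\<in>S. \<exists>U. open_box Y K U \<and> x \<in> PiE K U \<and> PiE K U \<subseteq> S)"
  unfolding openin_product_topology_alt open_box_def by simp

lemma openin_open_box: "open_box Y K U \<Longrightarrow> openin (product_topology Y K) (PiE K U)"
  by (simp add: openin_PiE_gen open_box_def)

text \<open>A geometric distribution pushed along an enumeration of a countable dense set charges
  each of its points, and every nonempty open set contains one. A pmf measures all subsets, so no
  Borel structure on \<open>Y\<close> enters.\<close>

lemma ex_pmf_dense_support:
  assumes "separable_space Y" and "topspace Y \<noteq> {}"
  shows "\<exists>p. \<forall>U. openin Y U \<and> U \<noteq> {} \<longrightarrow> measure (measure_pmf p) U > 0"
proof -
  obtain C where C: "countable C" "C \<subseteq> topspace Y" "Y closure_of C = topspace Y"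
    using assms(1) by (auto simp: separable_space_def)
  have "C \<noteq> {}"
    using C(3) assms(2) by (metis closure_of_empty)
  define p where "p = map_pmf (from_nat_into C) (geometric_pmf (1/2))"
  have p: "set_pmf p = C"
    using C(1) \<open>C \<noteq> {}\<close> by (simp add: p_def set_pmf_geometric)
  have "measure (measure_pmf p) U > 0" if U: "openin Y U" "U \<noteq> {}" for U
  proof -
    obtain y where "y \<in> U" "y \<in> topspace Y"
      using U openin_subset by blast
    then have "y \<in> Y closure_of C"
      using C(3) by simp
    then obtain c where "c \<in> C" "c \<in> U"
      using U(1) \<open>y \<in> U\<close> unfolding in_closure_of by blast
    then show ?thesis
      using p by (auto intro!: measure_pmf_posI)
  qed
  then show ?thesis by blast
qed

lemma countable_disjoint_open_boxes:
  assumes sep: "\<And>i. i \<in> K \<Longrightarrow> separable_space (Y i)"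
    and box: "\<And>U. U \<in> \<U> \<Longrightarrow> open_box Y K U"
    and ne: "\<And>U. U \<in> \<U> \<Longrightarrow> PiE K U \<noteq> {}"
    and disj: "disjoint_family_on (PiE K) \<U>"
  shows "countable \<U>"
proof (cases "\<U> = {}")
  case False
  have Yne: "topspace (Y i) \<noteq> {}" if "i \<in> K" for i
  proof -
    obtain U where "U \<in> \<U>" using False by blast
    with box[of U] ne[of U] that show ?thesis
      unfolding open_box_def by (metis PiE_eq_empty_iff openin_subset subset_empty)
  qed
  have "\<forall>i\<in>K. \<exists>p. \<forall>U. openin (Y i) U \<and> U \<noteq> {} \<longrightarrow> measure (measure_pmf p) U > 0"
    using ex_pmf_dense_support sep Yne by blast
  then obtain p where
    p: "\<And>i U. \<lbrakk>i \<in> K; openin (Y i) U; U \<noteq> {}\<rbrakk> \<Longrightarrow> measure (measure_pmf (p i)) U > 0"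
    by metis
  interpret product_prob_space "\<lambda>i. measure_pmf (p i)" K
    by (intro product_prob_spaceI measure_pmf.prob_space_axioms)
  define supp where "supp = (\<lambda>U. {i \<in> K. U i \<noteq> topspace (Y i)})"
  \<comment> \<open>\<open>PiE K U\<close> still confines every coordinate outside
    \<open>supp U\<close> to \<open>topspace (Y i)\<close>, possibly uncountably many conditions.
    The cylinder over the finite set \<open>supp U\<close> drops them, is measurable, and has a
    finite product as its measure.\<close>
  define A where "A = (\<lambda>U. emb K (supp U) (PiE (supp U) U))"
  have supp: "finite (supp U)" "supp U \<subseteq> K" if "U \<in> \<U>" for U
    using box[OF that] by (auto simp: supp_def open_box_def)
  have Une: "U i \<noteq> {}" if "U \<in> \<U>" "i \<in> K" for U i
    using ne[OF that(1)] that(2) by (auto simp: PiE_eq_empty_iff)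
  have "disjoint_family_on A \<U>"
    unfolding disjoint_family_on_def
  proof (intro ballI impI)
    fix U V assume UV: "U \<in> \<U>" "V \<in> \<U>" "U \<noteq> V"
    then have "PiE K U \<inter> PiE K V = {}"
      using disj by (auto simp: disjoint_family_on_def)
    then obtain i where i: "i \<in> K" "U i \<inter> V i = {}"
      by (auto simp: PiE_Int PiE_eq_empty_iff)
    have "U i \<subseteq> topspace (Y i)" "V i \<subseteq> topspace (Y i)"
      using box[OF UV(1)] box[OF UV(2)] i(1) openin_subset unfolding open_box_def by blast+
    \<comment> \<open>If one of two disjoint nonempty sides were the whole factor, it would contain
      the other. So the boxes are already separated at a restricted coordinate, and the cylinders
      stay disjoint.\<close>
    with i have "i \<in> supp U" "i \<in> supp V"
      using Une[OF UV(1) i(1)] Une[OF UV(2) i(1)] by (auto simp: supp_def)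
    with i show "A U \<inter> A V = {}"
      by (auto simp: A_def prod_emb_def PiE_iff disjoint_iff)
  qed
  moreover have "A U \<in> sets (PiM K (\<lambda>i. measure_pmf (p i)))" if "U \<in> \<U>" for U
    using supp[OF that] unfolding A_def by (intro sets_PiM_I) auto
  moreover have "measure (PiM K (\<lambda>i. measure_pmf (p i))) (A U) > 0" if "U \<in> \<U>" for U
  proof -
    have "measure (PiM K (\<lambda>i. measure_pmf (p i))) (A U)
        = (\<Prod>i\<in>supp U. measure (measure_pmf (p i)) (U i))"
      using supp[OF that] unfolding A_def by (intro measure_PiM_emb) auto
    also have "\<dots> > 0"
      using supp[OF that] box[OF that] Une[OF that]
      by (intro prod_pos) (auto intro!: p simp: open_box_def)
    finally show ?thesis .
  qed
  ultimately show ?thesis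
    by (rule P.countable_disjoint_family_positive)
qed auto

section \<open>Dependence on countably many coordinates\<close>

text \<open>\<open>W\<close> is the union of a maximal disjoint family of nonempty boxes inside
  \<open>S\<close>. Maximality makes it dense in \<open>S\<close>; the chain condition makes the
  family countable, and each box restricts finitely many coordinates.\<close>

lemma open_dense_part_countable_coordinates:
  assumes sep: "\<And>i. i \<in> K \<Longrightarrow> separable_space (Y i)"
    and S: "openin (product_topology Y K) S"
  obtains J W where "countable J" and "J \<subseteq> K" and "W \<subseteq> S"
    and "\<And>V. \<lbrakk>openin (product_topology Y K) V; V \<inter> S \<noteq> {}\<rbrakk> \<Longrightarrow> V \<inter> W \<noteq> {}"
    and "\<And>w z. \<lbrakk>w \<in> W; z \<in> topspace (product_topology Y K); \<forall>i\<in>J. z i = w i\<rbrakk> \<Longrightarrow> z \<in> W"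
proof -
  let ?P = "product_topology Y K"
  let ?B = "{U. open_box Y K U \<and> PiE K U \<noteq> {} \<and> PiE K U \<subseteq> S}"
  let ?F = "{\<U>. \<U> \<subseteq> ?B \<and> disjoint_family_on (PiE K) \<U>}"
  have "\<exists>\<M>\<in>?F. \<forall>\<U>\<in>?F. \<M> \<subseteq> \<U> \<longrightarrow> \<U> = \<M>"
  proof (rule subset_Zorn')
    fix C assume C: "subset.chain ?F C"
    then have CF: "C \<subseteq> ?F" and lin: "\<And>A B. A \<in> C \<Longrightarrow> B \<in> C \<Longrightarrow> A \<subseteq> B \<or> B \<subseteq> A"
      by (auto simp: subset_chain_def)
    have "disjoint_family_on (PiE K) (\<Union>C)"
      unfolding disjoint_family_on_def
    proof (intro ballI impI)
      fix U V assume "U \<in> \<Union>C" "V \<in> \<Union>C" and UV: "U \<noteq> V"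
      then obtain A where "A \<in> C" "U \<in> A" "V \<in> A"
        using lin by blast
      then show "PiE K U \<inter> PiE K V = {}"
        using CF UV by (intro disjoint_family_onD[of _ A]) auto
    qed
    with CF show "\<Union>C \<in> ?F" by blast
  qed
  then obtain \<M> where MB: "\<M> \<subseteq> ?B" and disj: "disjoint_family_on (PiE K) \<M>"
    and max: "\<And>\<U>. \<lbrakk>\<U> \<subseteq> ?B; disjoint_family_on (PiE K) \<U>; \<M> \<subseteq> \<U>\<rbrakk> \<Longrightarrow> \<U> = \<M>"
    by auto
  have "countable \<M>"
    by (rule countable_disjoint_open_boxes[OF sep _ _ disj]) (use MB in auto)
  define J where "J = (\<Union>U\<in>\<M>. {i \<in> K. U i \<noteq> topspace (Y i)})"
  define W where "W = (\<Union>U\<in>\<M>. PiE K U)"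
  have "countable J"
    unfolding J_def using MB \<open>countable \<M>\<close>
    by (intro countable_UN) (auto simp: open_box_def intro: countable_finite)
  moreover have "J \<subseteq> K" "W \<subseteq> S"
    using MB by (auto simp: J_def W_def)
  moreover have "V \<inter> W \<noteq> {}" if V: "openin ?P V" "V \<inter> S \<noteq> {}" for V
  proof
    assume VW: "V \<inter> W = {}"
    have "openin ?P (V \<inter> S)"
      using V S by blast
    \<comment> \<open>A box inside \<open>V \<inter> S\<close> that misses \<open>W\<close> could be
      added to \<open>\<M>\<close>; by maximality it is already a member, hence disjoint from
      itself, although nonempty.\<close>
    then obtain U where U: "open_box Y K U" "PiE K U \<noteq> {}" "PiE K U \<subseteq> V \<inter> S"
      using V(2) unfolding openin_product_topology_open_box by blast
    have UM: "PiE K U \<inter> PiE K U' = {}" if "U' \<in> \<M>" for U'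
      using U(3) VW that by (auto simp: W_def)
    have "disjoint_family_on (PiE K) (insert U \<M>)"
      using disj UM by (auto simp: disjoint_family_on_def)
    then have "U \<in> \<M>"
      using max[of "insert U \<M>"] U MB by auto
    then show False
      using UM U(2) by blast
  qed
  moreover have "z \<in> W" if w: "w \<in> W" and z: "z \<in> topspace ?P" "\<forall>i\<in>J. z i = w i" for w z
  proof -
    obtain U where U: "U \<in> \<M>" "w \<in> PiE K U"
      using w by (auto simp: W_def)
    have "z i \<in> U i" if "i \<in> K" for i
    proof (cases "i \<in> J")
      case True
      then show ?thesis using z U that by auto
    next
      case False
      then have "U i = topspace (Y i)"
        using U(1) that by (auto simp: J_def)
      then show ?thesis using z that by auto
    qed
    then have "z \<in> PiE K U"
      using z by (auto simp: PiE_iff)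
    then show ?thesis using U(1) by (auto simp: W_def)
  qed
  ultimately show ?thesis by (rule that)
qed

lemma separated_open_sets_countable_coordinates:
  assumes sep: "\<And>i. i \<in> K \<Longrightarrow> separable_space (Y i)"
    and S: "openin (product_topology Y K) S"
  obtains J where "countable J" and "J \<subseteq> K"
    and "\<And>T x y. \<lbrakk>openin (product_topology Y K) T; S \<inter> T = {}; x \<in> S; y \<in> T\<rbrakk>
      \<Longrightarrow> \<exists>i\<in>J. x i \<noteq> y i"
proof -
  let ?P = "product_topology Y K"
  obtain J W where J: "countable J" "J \<subseteq> K" and "W \<subseteq> S"
    and dense: "\<And>V. \<lbrakk>openin ?P V; V \<inter> S \<noteq> {}\<rbrakk> \<Longrightarrow> V \<inter> W \<noteq> {}"
    and dep: "\<And>w z. \<lbrakk>w \<in> W; z \<in> topspace ?P; \<forall>i\<in>J. z i = w i\<rbrakk> \<Longrightarrow> z \<in> W"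
    by (rule open_dense_part_countable_coordinates[OF sep S]) (auto 0 0 intro: that)
  have False if T: "openin ?P T" "S \<inter> T = {}" and xy: "x \<in> S" "y \<in> T" "\<forall>i\<in>J. x i = y i"
    for T x y
  proof -
    obtain V where V: "open_box Y K V" "y \<in> PiE K V" "PiE K V \<subseteq> T"
      using T(1) xy(2) unfolding openin_product_topology_open_box by blast
    \<comment> \<open>Freeing the coordinates outside \<open>J\<close> brings \<open>x\<close> into
      the box, since \<open>x\<close> and \<open>y\<close> agree on \<open>J\<close>. The enlarged
      box thus meets \<open>S\<close>, hence \<open>W\<close>.\<close>
    define V' where "V' = (\<lambda>i. if i \<in> J then V i else topspace (Y i))"
    have "open_box Y K V'"
      using V(1) unfolding open_box_def V'_def by (auto elim!: rev_finite_subset)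
    then have oV': "openin ?P (PiE K V')"
      by (rule openin_open_box)
    have xP: "x \<in> topspace ?P"
      using S xy(1) openin_subset by blast
    then have "x \<in> PiE K V'"
      using V(2) xy(3) J(2) by (auto simp: V'_def PiE_iff)
    then obtain w where w: "w \<in> W" "w \<in> PiE K V'"
      using dense[OF oV'] xy(1) by blast
    \<comment> \<open>The hybrid point lies in \<open>W\<close> because it agrees with
      \<open>w\<close> on \<open>J\<close>, and in \<open>PiE K V\<close> because its other
      coordinates are those of \<open>y\<close>. It is therefore common to \<open>S\<close> and
      \<open>T\<close>.\<close>
    define z where "z = (\<lambda>i. if i \<in> J then w i else y i)"
    have "z \<in> PiE K V"
      using w(2) V(2) J(2) by (auto simp: z_def V'_def PiE_iff extensional_def split: if_splits)
    moreover have "z \<in> topspace ?P"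
      using \<open>z \<in> PiE K V\<close> V(3) T(1) openin_subset by blast
    then have "z \<in> W"
      using dep[OF w(1)] by (simp add: z_def)
    ultimately show False
      using V(3) T(2) \<open>W \<subseteq> S\<close> by blast
  qed
  then have "\<exists>i\<in>J. x i \<noteq> y i"
    if "openin ?P T" "S \<inter> T = {}" "x \<in> S" "y \<in> T" for T x y
    using that by blast
  with J show ?thesis by (rule that)
qed

text \<open>Two values of \<open>f\<close> are separated by a rational \<open>q\<close>. The sets
  where \<open>f\<close> is below and above \<open>q\<close> are traces of disjoint open sets of the
  product, which countably many coordinates tell apart.\<close>

lemma continuous_map_depends_on_countable_coordinates:
  fixes f :: "('i \<Rightarrow> 'a) \<Rightarrow> real"
  assumes sep: "\<And>i. i \<in> K \<Longrightarrow> separable_space (Y i)"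
    and dense: "dense_in (product_topology Y K) X"
    and f: "continuous_map (subtopology (product_topology Y K) X) euclideanreal f"
  obtains J where "countable J" and "J \<subseteq> K"
    and "\<forall>x\<in>X. \<forall>y\<in>X. (\<forall>i\<in>J. x i = y i) \<longrightarrow> f x = f y"
proof -
  let ?P = "product_topology Y K"
  have XP: "X \<subseteq> topspace ?P" and cl: "?P closure_of X = topspace ?P"
    using dense by (auto simp: dense_in_def)
  have "topspace (subtopology ?P X) = X"
    using XP by auto
  then have trace: "\<exists>G. openin ?P G \<and> {x \<in> X. f x \<in> Q} = G \<inter> X" if "open Q" for Q
    using openin_continuous_map_preimage[OF f, of Q] that
    by (simp add: openin_subtopology Int_absorb1)
  have "\<exists>G. openin ?P G \<and> {x \<in> X. f x \<in> {..<q}} = G \<inter> X" for q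
    by (intro trace) simp
  then obtain L where L: "\<And>q. openin ?P (L q)" "\<And>q. {x \<in> X. f x \<in> {..<q}} = L q \<inter> X"
    by metis
  have "\<exists>G. openin ?P G \<and> {x \<in> X. f x \<in> {q<..}} = G \<inter> X" for q
    by (intro trace) simp
  then obtain R where R: "\<And>q. openin ?P (R q)" "\<And>q. {x \<in> X. f x \<in> {q<..}} = R q \<inter> X"
    by metis
  \<comment> \<open>Disjointness is known only on \<open>X\<close>; it passes to the product because
    a nonempty open intersection would contain a point of the dense set \<open>X\<close>.\<close>
  have LR: "L q \<inter> R q = {}" for q
  proof (rule ccontr)
    assume "L q \<inter> R q \<noteq> {}"
    then obtain a where a: "a \<in> L q \<inter> R q" by blast
    have "openin ?P (L q \<inter> R q)"
      using L(1) R(1) by blast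
    moreover have "a \<in> ?P closure_of X"
      using a L(1)[of q] cl openin_subset by blast
    ultimately obtain x where "x \<in> X" "x \<in> L q \<inter> R q"
      using a unfolding in_closure_of by blast
    then show False
      using L(2)[of q, THEN eqset_imp_iff, of x] R(2)[of q, THEN eqset_imp_iff, of x] by simp
  qed
  have "\<exists>J. countable J \<and> J \<subseteq> K \<and> (\<forall>y\<in>R q. \<forall>x\<in>L q. \<exists>i\<in>J. x i \<noteq> y i)" for q
  proof -
    obtain J where "countable J" "J \<subseteq> K"
      and "\<And>T x y. \<lbrakk>openin ?P T; L q \<inter> T = {}; x \<in> L q; y \<in> T\<rbrakk> \<Longrightarrow> \<exists>i\<in>J. x i \<noteq> y i"
      by (rule separated_open_sets_countable_coordinates[OF sep L(1)[of q]]) (auto 0 0 intro: that)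
    from this(1,2) this(3)[OF R(1) LR] show ?thesis by (intro exI[of _ J] conjI ballI)
  qed
  then obtain J where J: "\<And>q. countable (J q)" "\<And>q. J q \<subseteq> K"
    and Jsep: "\<And>q x y. \<lbrakk>x \<in> L q; y \<in> R q\<rbrakk> \<Longrightarrow> \<exists>i\<in>J q. x i \<noteq> y i"
    by metis
  \<comment> \<open>Only rational \<open>q\<close> enter the union, which keeps it
    countable.\<close>
  have less: "\<exists>i\<in>(\<Union>q\<in>\<rat>. J q). x i \<noteq> y i"
    if xy: "x \<in> X" "y \<in> X" "f x < f y" for x y
  proof -
    obtain q where q: "q \<in> \<rat>" "f x < q" "q < f y"
      using Rats_dense_in_real[OF xy(3)] by blast
    then have "x \<in> L q" "y \<in> R q"
      using L(2)[of q] R(2)[of q] xy by auto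
    then have "\<exists>i\<in>J q. x i \<noteq> y i"
      by (rule Jsep)
    with q(1) show ?thesis by blast
  qed
  have "countable (\<Union>q\<in>\<rat>. J q)" "(\<Union>q\<in>\<rat>. J q) \<subseteq> K"
    using J by (auto intro: countable_UN countable_rat)
  moreover have "\<forall>x\<in>X. \<forall>y\<in>X. (\<forall>i\<in>(\<Union>q\<in>\<rat>. J q). x i = y i) \<longrightarrow> f x = f y"
    using less by (metis linorder_neqE)
  ultimately show ?thesis by (rule that)
qed

section \<open>Functional countability\<close>

lemma functionally_countable_dense_finite_support:
  fixes X :: "('i \<Rightarrow> 'a::zero) set"
  assumes sep: "\<And>i. i \<in> K \<Longrightarrow> separable_space (Y i)"
    and dense: "dense_in (product_topology Y K) X"
    and fin: "\<And>x. x \<in> X \<Longrightarrow> finite {i \<in> K. x i \<noteq> 0}"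
    and C: "countable C" "\<And>x. x \<in> X \<Longrightarrow> x ` K \<subseteq> C"
  shows "functionally_countable (subtopology (product_topology Y K) X)"
  unfolding functionally_countable_def
proof (intro allI impI)
  let ?T = "subtopology (product_topology Y K) X"
  fix f assume f: "continuous_map ?T euclideanreal f"
  obtain J where J: "countable J" "J \<subseteq> K"
    and dep: "\<forall>x\<in>X. \<forall>y\<in>X. (\<forall>i\<in>J. x i = y i) \<longrightarrow> f x = f y"
    by (rule continuous_map_depends_on_countable_coordinates[OF sep dense f])
  \<comment> \<open>\<open>G x\<close> is the graph of \<open>x\<close> over its support in
    \<open>J\<close>. A missing coordinate stands for the value 0, so this finite subset of
    \<open>J \<times> C\<close> determines \<open>x\<close> on \<open>J\<close>.\<close>
  define G where "G x = {(i, x i) | i. i \<in> J \<and> x i \<noteq> 0}" for x :: "'i \<Rightarrow> 'a"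
  have GX: "G ` X \<subseteq> {A. A \<subseteq> J \<times> C \<and> finite A}"
  proof clarify
    fix x assume x: "x \<in> X"
    have "G x = (\<lambda>i. (i, x i)) ` {i \<in> J. x i \<noteq> 0}"
      by (auto simp: G_def)
    moreover have "finite {i \<in> J. x i \<noteq> 0}"
      using fin[OF x] J(2) by (auto elim!: rev_finite_subset)
    ultimately show "G x \<subseteq> J \<times> C \<and> finite (G x)"
      using C(2)[OF x] J(2) by auto
  qed
  have "countable {A. A \<subseteq> J \<times> C \<and> finite A}"
    using J(1) C(1) by (simp add: countable_Collect_finite_subset conj_commute)
  then have "countable (G ` X)"
    using GX countable_subset by blast
  \<comment> \<open>\<open>f\<close> factors through \<open>G\<close>: the representative chosen by
    \<open>inv_into\<close> has the same graph, hence agrees with \<open>x\<close> on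
    \<open>J\<close> and has the same image under \<open>f\<close>.\<close>
  moreover have "f ` X \<subseteq> (\<lambda>A. f (inv_into X G A)) ` G ` X"
  proof
    fix r assume "r \<in> f ` X"
    then obtain x where x: "x \<in> X" "r = f x" by blast
    define y where "y = inv_into X G (G x)"
    have y: "y \<in> X" "G y = G x"
      using x(1) by (auto simp: y_def inv_into_into f_inv_into_f)
    have "x i = y i" if "i \<in> J" for i
    proof -
      have "(i, a) \<in> G x \<longleftrightarrow> (i, a) \<in> G y" for a
        using y(2) by simp
      then show ?thesis
        using that by (auto simp: G_def) metis
    qed
    then have "f x = f y"
      using dep x(1) y(1) by blast
    then show "r \<in> (\<lambda>A. f (inv_into X G A)) ` G ` X"
      using x by (auto simp: y_def)
  qed
  ultimately have "countable (f ` X)"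
    by (meson countable_image countable_subset)
  then show "countable (f ` topspace ?T)"
    by (rule countable_subset[rotated]) auto
qed

section \<open>Closed discrete sets\<close>

text \<open>Isolating neighbourhoods in the ambient space can be multiplied, which makes this form
  suitable for products.\<close>

lemma closed_discrete_in_iff:
  "closed_discrete_in T D \<longleftrightarrow> closedin T D \<and> (\<forall>x\<in>D. \<exists>U. openin T U \<and> U \<inter> D = {x})"
proof -
  have "subtopology T D = discrete_topology D \<longleftrightarrow> (\<forall>x\<in>D. \<exists>U. openin T U \<and> U \<inter> D = {x})"
    if "closedin T D"
  proof -
    have "topspace (subtopology T D) = D"
      using closedin_subset[OF that] by auto
    then have "subtopology T D = discrete_topology D \<longleftrightarrow> (\<forall>x\<in>D. openin (subtopology T D) {x})"
      using discrete_topology_unique[of D "subtopology T D"] by auto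
    then show ?thesis
      by (metis openin_subtopology)
  qed
  then show ?thesis
    by (auto simp: closed_discrete_in_def)
qed

lemma closedin_subset_closed_discrete_in:
  assumes "closed_discrete_in T D" and "S \<subseteq> D"
  shows "closedin T S"
  using assms closedin_closed_subtopology[of T D S] by (simp add: closed_discrete_in_def)

lemma closed_discrete_in_Times:
  assumes "closed_discrete_in T D" and "closed_discrete_in T' E"
  shows "closed_discrete_in (prod_topology T T') (D \<times> E)"
  unfolding closed_discrete_in_iff
proof (intro conjI ballI)
  show "closedin (prod_topology T T') (D \<times> E)"
    using assms by (simp add: closed_discrete_in_def closedin_prod_Times_iff)
next
  fix z assume "z \<in> D \<times> E"
  then obtain x y where z: "z = (x, y)" "x \<in> D" "y \<in> E" by blast
  obtain U where U: "openin T U" "U \<inter> D = {x}"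
    using assms(1) z(2) unfolding closed_discrete_in_iff by blast
  obtain V where V: "openin T' V" "V \<inter> E = {y}"
    using assms(2) z(3) unfolding closed_discrete_in_iff by blast
  have "openin (prod_topology T T') (U \<times> V)"
    using U(1) V(1) by (simp add: openin_prod_Times_iff)
  moreover have "(U \<times> V) \<inter> (D \<times> E) = {z}"
    using U(2) V(2) z(1) by (simp add: Times_Int_Times)
  ultimately show "\<exists>W. openin (prod_topology T T') W \<and> W \<inter> D \<times> E = {z}"
    by blast
qed

section \<open>The diagonal\<close>

lemma has_gdelta_diagonal_sigma_closed_discrete:
  assumes "countable \<D>" and "topspace T = \<Union>\<D>" and D: "\<And>D. D \<in> \<D> \<Longrightarrow> closed_discrete_in T D"
  shows "has_gdelta_diagonal T"
proof -
  let ?\<Delta> = "{(x, x) | x. x \<in> topspace T}"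
  have "topspace (prod_topology T T) - ?\<Delta> = \<Union>((\<lambda>(D, E). D \<times> E - ?\<Delta>) ` (\<D> \<times> \<D>))"
    using assms(2) by auto
  \<comment> \<open>Removing diagonal points from the closed discrete set
    \<open>D \<times> E\<close> leaves a subset of it, which is again closed.\<close>
  moreover have "fsigma_in (prod_topology T T) (D \<times> E - ?\<Delta>)" if "D \<in> \<D>" "E \<in> \<D>" for D E
    using closed_discrete_in_Times[OF D D, OF that]
    by (intro closed_imp_fsigma_in) (auto elim: closedin_subset_closed_discrete_in)
  ultimately have "fsigma_in (prod_topology T T) (topspace (prod_topology T T) - ?\<Delta>)"
    using assms(1) by (auto intro!: fsigma_in_Union)
  then show ?thesis
    unfolding has_gdelta_diagonal_def gdelta_in_fsigma_in by auto
qed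

section \<open>Failure of exponential separability\<close>

text \<open>\<open>D\<close> may be larger than the continuum and then has no injection into the
  reals; in that case it contains a copy of the reals, which serves as \<open>E\<close>.\<close>

lemma uncountable_subset_inj_real:
  assumes "uncountable D"
  shows "\<exists>E\<subseteq>D. uncountable E \<and> (\<exists>g :: 'a \<Rightarrow> real. inj_on g E)"
proof -
  consider "|D| \<le>o |UNIV :: real set|" | "|UNIV :: real set| \<le>o |D|"
    using ordLeq_total[OF card_of_Well_order card_of_Well_order] by blast
  then show ?thesis
  proof cases
    case 1
    then show ?thesis
      using assms by (metis card_of_ordLeq order_refl)
  next
    case 2
    then obtain h :: "real \<Rightarrow> 'a" where h: "inj h" "range h \<subseteq> D"
      by (metis card_of_ordLeq)
    then have "uncountable (range h)"
      using uncountable_UNIV_real countable_image_inj_on by blast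
    moreover have "inj_on (inv h) (range h)"
      by (rule inj_on_inv_into) simp
    ultimately show ?thesis
      using h(2) by blast
  qed
qed

lemma not_exponentially_separable_closed_discrete:
  assumes D: "closed_discrete_in T D" and "uncountable D"
  shows "\<not> exponentially_separable T"
proof
  assume exp: "exponentially_separable T"
  obtain E and g :: "'a \<Rightarrow> real" where E: "E \<subseteq> D" "uncountable E" and g: "inj_on g E"
    using uncountable_subset_inj_real[OF assms(2)] by blast
  define \<F> where "\<F> = (\<lambda>q. {x \<in> E. g x \<le> q}) ` \<rat> \<union> (\<lambda>q. {x \<in> E. q \<le> g x}) ` \<rat>"
  have "countable \<F>"
    by (simp add: \<F>_def countable_rat)
  moreover have "closedin T F" if "F \<in> \<F>" for F
    using that E(1) by (intro closedin_subset_closed_discrete_in[OF D]) (auto simp: \<F>_def)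
  ultimately obtain A where A: "countable A" "strongly_dense_in T A \<F>"
    using exp unfolding exponentially_separable_def by blast
  have "x \<in> A" if x: "x \<in> E" for x
  proof -
    \<comment> \<open>Strong density, applied to all members through \<open>x\<close>, gives a point
      of \<open>A\<close> in their intersection. The rational half-lines squeeze its
      \<open>g\<close>-value to \<open>g x\<close>, so injectivity makes it \<open>x\<close>
      itself.\<close>
    let ?\<G> = "{F \<in> \<F>. x \<in> F}"
    have "x \<in> topspace T"
      using D E(1) x closedin_subset unfolding closed_discrete_in_def by blast
    then have "?\<G> \<subseteq> \<F>" "x \<in> topspace T \<inter> \<Inter>?\<G>"
      by auto
    then have "A \<inter> \<Inter>?\<G> \<noteq> {}"
      using A(2) unfolding strongly_dense_in_def by (metis empty_iff)
    then obtain y where y: "y \<in> A" "\<And>F. F \<in> \<F> \<Longrightarrow> x \<in> F \<Longrightarrow> y \<in> F"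
      by auto
    have le: "y \<in> E \<and> g y \<le> q" if "q \<in> \<rat>" "g x \<le> q" for q
      using y(2)[of "{x \<in> E. g x \<le> q}"] that x by (auto simp: \<F>_def)
    have ge: "q \<le> g y" if "q \<in> \<rat>" "q \<le> g x" for q
      using y(2)[of "{x \<in> E. q \<le> g x}"] that x by (auto simp: \<F>_def)
    \<comment> \<open>Any rational above \<open>g x\<close> gives a member of \<open>\<F>\<close>
      through \<open>x\<close>, and that member lies in \<open>E\<close>.\<close>
    have "y \<in> E"
      using le Rats_dense_in_real[of "g x" "g x + 1"] by force
    moreover have "\<not> g x < g y"
      using le Rats_dense_in_real[of "g x" "g y"] by force
    moreover have "\<not> g y < g x"
      using ge Rats_dense_in_real[of "g y" "g x"] by force
    ultimately have "y = x"
      using g x by (metis inj_onD linorder_neqE)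
    with y(1) show ?thesis by simp
  qed
  then have "countable E"
    by (intro countable_subset[OF _ A(1)]) blast
  with E(2) show False by simp
qed

section \<open>Uspenskij's example and its extent\<close>

theorem theorem12:
  fixes \<kappa> :: "'k rel" and X :: "('k \<Rightarrow> real) set"
  defines "T \<equiv> subtopology (tychonoff_cube \<kappa>) X"
  assumes "Card_order \<kappa>" and "uncountable (Field \<kappa>)"
    and "X \<subseteq> topspace (tychonoff_cube \<kappa>)" and "|X| =o \<kappa>"
    and "dense_in (tychonoff_cube \<kappa>) X"
    and "\<exists>\<D>. countable \<D> \<and> X = \<Union>\<D> \<and> (\<forall>D\<in>\<D>. closed_discrete_in T D \<and> |D| =o \<kappa>)"
    and "\<forall>f\<in>X. finite {\<alpha> \<in> Field \<kappa>. f \<alpha> \<noteq> 0}"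
    and "\<exists>C\<subseteq>{0..1}. countable C \<and> (\<forall>f\<in>X. f ` Field \<kappa> \<subseteq> C)"
  shows "functionally_countable T \<and> has_gdelta_diagonal T \<and> has_extent T \<kappa> \<and>
    \<not> exponentially_separable T"
proof -
  have TX: "topspace T = X"
    using assms(4) by (auto simp: T_def)
  obtain \<D> where \<D>: "countable \<D>" "X = \<Union>\<D>"
    and cd: "\<And>D. D \<in> \<D> \<Longrightarrow> closed_discrete_in T D" and card: "\<And>D. D \<in> \<D> \<Longrightarrow> |D| =o \<kappa>"
    using assms(7) by blast
  have uncountable: "uncountable S" if "|S| =o \<kappa>" for S :: "('k \<Rightarrow> real) set"
  proof -
    have "|S| =o |Field \<kappa>|"
      using that assms(2) card_of_Field_ordIso ordIso_symmetric ordIso_transitive by blast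
    then obtain h where "bij_betw h S (Field \<kappa>)"
      using card_of_ordIso by blast
    then show ?thesis
      using assms(3) by (metis bij_betw_def countable_image)
  qed
  \<comment> \<open>Nonemptiness of \<open>X\<close> yields a member of \<open>\<D>\<close>. This
    one closed discrete set of cardinality \<kappa> both bounds the extent from below and refutes
    exponential separability.\<close>
  have "X \<noteq> {}"
    using uncountable[OF assms(5)] by auto
  then obtain D where D: "D \<in> \<D>"
    using \<D>(2) by blast
  have sep: "separable_space (top_of_set {0..1::real})"
  proof -
    obtain C where "countable C" "C \<subseteq> {0..1::real}" "{0..1} \<subseteq> closure C"
      using separable by blast
    then show ?thesis
      unfolding separable_space_def
      by (intro exI[of _ C]) (auto simp: closure_of_subtopology Int_absorb1)
  qed
  obtain C where "countable C" "\<forall>f\<in>X. f ` Field \<kappa> \<subseteq> C"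
    using assms(9) by auto
  then have "functionally_countable T"
    using assms(6,8) sep unfolding T_def tychonoff_cube_def
    by (intro functionally_countable_dense_finite_support[where C = C]) simp_all
  moreover have "has_gdelta_diagonal T"
    by (rule has_gdelta_diagonal_sigma_closed_discrete[OF \<D>(1)]) (use \<D>(2) cd TX in simp_all)
  moreover have "has_extent T \<kappa>"
    unfolding has_extent_def
  proof (intro conjI allI impI)
    fix E assume "closed_discrete_in T E"
    \<comment> \<open>The upper bound on the extent is the cardinality of \<open>X\<close>
      itself.\<close>
    then have "E \<subseteq> X"
      using closedin_subset TX unfolding closed_discrete_in_def by blast
    then show "|E| \<le>o \<kappa>"
      using card_of_mono1 assms(5) ordLeq_ordIso_trans by blast
  next
    fix s :: "'k rel" assume "Card_order s \<and> (\<forall>E. closed_discrete_in T E \<longrightarrow> |E| \<le>o s)"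
    then show "\<kappa> \<le>o s"
      using cd[OF D] card[OF D] ordIso_symmetric ordIso_ordLeq_trans by blast
  qed (use assms(2) in simp)
  moreover have "\<not> exponentially_separable T"
    using cd[OF D] uncountable[OF card[OF D]] by (rule not_exponentially_separable_closed_discrete)
  ultimately show ?thesis by blast
qed

end
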